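(* In the uplink of the scalable cell-free massive MIMO system with transceiver hardware impairments described in the context, consider the combiner for user $k$ at channel use $n$ obtained by minimizing the individual mean-squared error $\mathrm{MSE}_{k,n}$ (given in the context) with respect to the combining vector, and then taking scalability into account by including only the users in $\mathcal P_k$. This hardware-aware partial MMSE (HA-PMMSE) receive combining vector, which takes into account the transceiver hardware impairments, is written as $$\mathbf v_{k,n}^{\mathrm{HA\text{-}PMMSE}}=\rho_k\Big(\sum_{i\in\mathcal P_k}\rho_i(1+\kappa_{\mathrm t}^2)\,\mathbf D_k\big(\hat{\mathbf h}_{i,n}\hat{\mathbf h}_{i,n}^{\mathsf H}+\boldsymbol\kappa_{\mathrm r}^2\rho_i\mathbf F_{|\hat{\mathbf h}_i|^2}+\xi\mathbf I_W\big)\mathbf D_k+\tilde{\boldsymbol\Delta}\Big)^{\dagger}\mathbf D_k\hat{\mathbf h}_{k,n},$$ where $\tilde{\boldsymbol\Delta}=\sum_{i\in\mathcal P_k}\mathbf D_k\tilde{\boldsymbol\Delta}_i\mathbf D_k$, and $\tilde{\boldsymbol\Delta}_i$ is the covariance matrix including the estimation error matrix and the hardware impairments, given by $$\tilde{\boldsymbol\Delta}_i=\rho_i(1+\kappa_{\mathrm t}^2)\tilde{\mathbf R}_i+\boldsymbol\kappa_{\mathrm r}^2\rho_i\mathbf F_{|\tilde{\mathbf R}_i|^2}.$$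
   Context: Setting: uplink of a cell-free network with $M$ access points (APs) of $L$ antennas each, $W=ML$, and $K$ single-antenna users with transmit powers $\rho_i$. $(\cdot)^{\mathsf H}$ is the conjugate transpose and $(\cdot)^\dagger$ the pseudo-inverse. Clustering: for each AP $m$ a set $\mathcal D_m\subseteq\{1,\dots,K\}$ of served users is given; $\mathbf D_{mi}=\mathbf I_L$ if $i\in\mathcal D_m$ and $\mathbf D_{mi}=\mathbf 0$ otherwise; $\mathbf D_i=\mathrm{diag}(\mathbf D_{1i},\dots,\mathbf D_{Mi})\in\mathbb C^{W\times W}$ is block diagonal. $\mathcal P_k=\{i:\mathbf D_k\mathbf D_i\ne\mathbf 0\}$ is the set of users sharing at least one serving AP with user $k$. Channels: the effective channel of user $i$ at channel use $n$ is $\mathbf h_{i,n}=\boldsymbol\Theta_{i,n}\mathbf h_i\in\mathbb C^W$, with $\mathbf h_i\sim\mathcal{CN}(\mathbf 0,\mathbf R_i)$, $\mathbf R_i$ block diagonal with $M$ blocks of size $L\times L$, and $\boldsymbol\Theta_{i,n}$ the diagonal unitary matrix of phase noises. $\hat{\mathbf h}_{i,n}$ is its linear MMSE estimate from received pilots, with covariance $\boldsymbol\Phi_i$ (block diagonal), and $\tilde{\mathbf R}_i=\mathbf R_i-\boldsymbol\Phi_i$ is the estimation error covariance matrix. Received signal at a data channel use: $\mathbf y_n=\sum_{i=1}^K\mathbf h_{i,n}(s_{i,n}+\delta^i_{\mathrm t,n})+\boldsymbol\delta_{\mathrm r,n}+\boldsymbol\xi_n$, where $s_{i,n}$ is the data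 symbol of power $\rho_i$; $\delta^i_{\mathrm t,n}\sim\mathcal{CN}(0,\kappa_{\mathrm t}^2\rho_i)$ is the transmit distortion; $\boldsymbol\delta_{\mathrm r,n}$ is the receive distortion, which given the channels is $\mathcal{CN}(\mathbf 0,\boldsymbol\kappa_{\mathrm r}^2\sum_{i=1}^K\rho_i\mathbf F_{|\mathbf h_i|^2})$; and $\boldsymbol\xi_n\sim\mathcal{CN}(\mathbf 0,\xi\mathbf I_W)$ is the amplified thermal noise. Here $\boldsymbol\kappa_{\mathrm r}^2=\mathrm{diag}(\kappa_{\mathrm r_1}^2\mathbf I_L,\dots,\kappa_{\mathrm r_M}^2\mathbf I_L)$ collects the receive distortion levels of the APs. The detected symbol is $\hat s_{k,n}=\mathbf v_{k,n}^{\mathsf H}\mathbf D_k\mathbf y_n$. Notation: $\mathbf F_{|\mathbf h_i|^2}$ and $\mathbf F_{|\hat{\mathbf h}_i|^2}$ are the diagonal matrices of squared moduli of the entries of $\mathbf h_i$ and of the channel estimate $\hat{\mathbf h}_{i,n}$, respectively; $\mathbf F_{|\tilde{\mathbf R}_i|^2}$ is the diagonal matrix with the same diagonal entries as $\tilde{\mathbf R}_i$. Mean-squared error: conditioned on the channel estimates, $$\mathrm{MSE}_{k,n}=\mathbf v_{k,n}^{\mathsf H}\mathbf D_k\Big(\sum_{i=1}^K\rho_i(1+\kappa_{\mathrm t}^2)(\hat{\mathbf h}_{i,n}\hat{\mathbf h}_{i,n}^{\mathsf H}+\tilde{\mathbf R}_i)+\boldsymbol\kappa_{\mathrm r}^2\sum_{i=1}^K\rho_i(\mathbf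 F_{|\hat{\mathbf h}_i|^2}+\mathbf F_{|\tilde{\mathbf R}_i|^2})+\xi\mathbf I_W\Big)\mathbf D_k\mathbf v_{k,n}-\rho_k\mathbf v_{k,n}^{\mathsf H}\mathbf D_k\hat{\mathbf h}_{k,n}-\rho_k\hat{\mathbf h}_{k,n}^{\mathsf H}\mathbf D_k\mathbf v_{k,n}+\rho_k .$$
   Formalization: The printed formula does not minimize the MSE; in the proved version ρ_i(1+κ_t²) multiplies only ĥĥ^H, κ_r²ρ_iF enters without that factor, and ξI_W occurs once, outside the sum over users. The combiner is the least-norm minimizer of the MSE with sums restricted to P_k. *)

theory Defs
  imports "HOL-Analysis.Analysis"
begin

text \<open>
  Access points, antennas of one access point and users are indexed by finite types 'm, 'l and 'k,
  so M, L and K are their cardinalities and vectors with W = ML complex entries are indexed by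
  pairs in 'm \<times> 'l.
\<close>

section \<open>Complex vectors and matrices\<close>

definition hprod :: "complex ^ 'n \<Rightarrow> complex ^ 'n \<Rightarrow> complex" where
  "hprod v w = (\<Sum>p\<in>UNIV. cnj (v $ p) * w $ p)"

definition outer :: "complex ^ 'n \<Rightarrow> complex ^ 'n \<Rightarrow> complex ^ 'n ^ 'n" where
  "outer v w = (\<chi> p q. v $ p * cnj (w $ q))"

definition ctranspose :: "complex ^ 'n ^ 'm \<Rightarrow> complex ^ 'm ^ 'n" where
  "ctranspose A = (\<chi> p q. cnj (A $ q $ p))"

definition hermitian :: "complex ^ 'n ^ 'n \<Rightarrow> bool" where
  "hermitian A \<longleftrightarrow> ctranspose A = A"

definition psd :: "complex ^ 'n ^ 'n \<Rightarrow> bool" where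
  "psd A \<longleftrightarrow> hermitian A \<and> (\<forall>v. 0 \<le> Re (hprod v (A *v v)))"

definition is_pseudo_inverse :: "complex ^ 'n ^ 'm \<Rightarrow> complex ^ 'm ^ 'n \<Rightarrow> bool" where
  "is_pseudo_inverse A X \<longleftrightarrow>
     A ** X ** A = A \<and> X ** A ** X = X \<and> hermitian (A ** X) \<and> hermitian (X ** A)"

definition pseudo_inverse :: "complex ^ 'n ^ 'm \<Rightarrow> complex ^ 'm ^ 'n" where
  "pseudo_inverse A = (THE X. is_pseudo_inverse A X)"

definition diag_mat :: "('n \<Rightarrow> complex) \<Rightarrow> complex ^ 'n ^ 'n" where
  "diag_mat d = (\<chi> p q. if p = q then d p else 0)"

definition block_diag :: "('m::finite \<Rightarrow> complex ^ 'l::finite ^ 'l) \<Rightarrow> complex ^ ('m \<times> 'l) ^ ('m \<times> 'l)" where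
  "block_diag B = (\<chi> p q. if fst p = fst q then B (fst p) $ snd p $ snd q else 0)"

text \<open>The diagonal matrix of squared moduli of a vector, and the diagonal part of a matrix.\<close>

definition F_vec :: "complex ^ 'n \<Rightarrow> complex ^ 'n ^ 'n" where
  "F_vec h = diag_mat (\<lambda>p. complex_of_real ((cmod (h $ p))\<^sup>2))"

definition F_mat :: "complex ^ 'n ^ 'n \<Rightarrow> complex ^ 'n ^ 'n" where
  "F_mat A = diag_mat (\<lambda>p. A $ p $ p)"

section \<open>The uplink\<close>

text \<open>The set of users served by access point m is serv m.\<close>

definition D_mat :: "('m::finite \<Rightarrow> 'k set) \<Rightarrow> 'k \<Rightarrow> complex ^ ('m \<times> 'l::finite) ^ ('m \<times> 'l)" where
  "D_mat serv i = block_diag (\<lambda>m. if i \<in> serv m then mat 1 else 0)"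

definition partners :: "'l::finite itself \<Rightarrow> ('m::finite \<Rightarrow> 'k set) \<Rightarrow> 'k \<Rightarrow> 'k set" where
  "partners _ serv k =
     {i. (D_mat serv k :: complex ^ ('m \<times> 'l) ^ ('m \<times> 'l)) ** D_mat serv i \<noteq> 0}"

definition kr2_mat :: "('m::finite \<Rightarrow> real) \<Rightarrow> complex ^ ('m \<times> 'l::finite) ^ ('m \<times> 'l)" where
  "kr2_mat \<kappa>r = block_diag (\<lambda>m. (\<kappa>r m)\<^sup>2 *\<^sub>R mat 1)"

text \<open>
  In the following, \<rho> are the transmit powers, \<kappa>t and \<kappa>r the levels of transmit and receive
  distortion, \<xi> is the noise power, Rt i the error covariance and g i the channel estimate of
  user i.  The mean-squared error of user k is formed from the users in the set S: all
  users for S = UNIV, only the partners of user k in the partial problem.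
\<close>

definition mse_mat ::
  "('k \<Rightarrow> real) \<Rightarrow> real \<Rightarrow> ('m::finite \<Rightarrow> real) \<Rightarrow> real \<Rightarrow>
   ('k \<Rightarrow> complex ^ ('m \<times> 'l::finite) ^ ('m \<times> 'l)) \<Rightarrow>
   ('k \<Rightarrow> complex ^ ('m \<times> 'l)) \<Rightarrow> 'k set \<Rightarrow> complex ^ ('m \<times> 'l) ^ ('m \<times> 'l)" where
  "mse_mat \<rho> \<kappa>t \<kappa>r \<xi> Rt g S =
     (\<Sum>i\<in>S. (\<rho> i * (1 + \<kappa>t\<^sup>2)) *\<^sub>R (outer (g i) (g i) + Rt i))
     + kr2_mat \<kappa>r ** (\<Sum>i\<in>S. \<rho> i *\<^sub>R (F_vec (g i) + F_mat (Rt i)))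
     + \<xi> *\<^sub>R mat 1"

definition mse_complex ::
  "('m::finite \<Rightarrow> 'k set) \<Rightarrow> ('k \<Rightarrow> real) \<Rightarrow> real \<Rightarrow> ('m \<Rightarrow> real) \<Rightarrow> real \<Rightarrow>
   ('k \<Rightarrow> complex ^ ('m \<times> 'l::finite) ^ ('m \<times> 'l)) \<Rightarrow> ('k \<Rightarrow> complex ^ ('m \<times> 'l)) \<Rightarrow>
   'k set \<Rightarrow> 'k \<Rightarrow> complex ^ ('m \<times> 'l) \<Rightarrow> complex" where
  "mse_complex serv \<rho> \<kappa>t \<kappa>r \<xi> Rt g S k v =
     hprod v ((D_mat serv k ** mse_mat \<rho> \<kappa>t \<kappa>r \<xi> Rt g S ** D_mat serv k) *v v)
     - complex_of_real (\<rho> k) * hprod v (D_mat serv k *v g k)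
     - complex_of_real (\<rho> k) * hprod (g k) (D_mat serv k *v v)
     + complex_of_real (\<rho> k)"

text \<open>The value of the complex expression is real; see mse_complex_real below.\<close>

definition mse ::
  "('m::finite \<Rightarrow> 'k set) \<Rightarrow> ('k \<Rightarrow> real) \<Rightarrow> real \<Rightarrow> ('m \<Rightarrow> real) \<Rightarrow> real \<Rightarrow>
   ('k \<Rightarrow> complex ^ ('m \<times> 'l::finite) ^ ('m \<times> 'l)) \<Rightarrow> ('k \<Rightarrow> complex ^ ('m \<times> 'l)) \<Rightarrow>
   'k set \<Rightarrow> 'k \<Rightarrow> complex ^ ('m \<times> 'l) \<Rightarrow> real" where
  "mse serv \<rho> \<kappa>t \<kappa>r \<xi> Rt g S k v = Re (mse_complex serv \<rho> \<kappa>t \<kappa>r \<xi> Rt g S k v)"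

text \<open>
  The mean-squared error depends on v only through D_mat serv k *v v, so its minimizers are not
  unique unless every access point serves user k; the pseudo-inverse selects the one of least norm.
\<close>

definition min_norm_minimizer :: "('v::real_normed_vector \<Rightarrow> real) \<Rightarrow> 'v \<Rightarrow> bool" where
  "min_norm_minimizer f v \<longleftrightarrow> is_arg_min norm (is_arg_min f (\<lambda>_. True)) v"

definition Delta ::
  "('k \<Rightarrow> real) \<Rightarrow> real \<Rightarrow> ('m::finite \<Rightarrow> real) \<Rightarrow> ('k \<Rightarrow> complex ^ ('m \<times> 'l::finite) ^ ('m \<times> 'l)) \<Rightarrow>
   'k \<Rightarrow> complex ^ ('m \<times> 'l) ^ ('m \<times> 'l)" where
  "Delta \<rho> \<kappa>t \<kappa>r Rt i =
     (\<rho> i * (1 + \<kappa>t\<^sup>2)) *\<^sub>R Rt i + kr2_mat \<kappa>r ** (\<rho> i *\<^sub>R F_mat (Rt i))"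

text \<open>
  As in mse_mat, the factor \<rho> i (1 + \<kappa>t^2) multiplies the rank-one term only, and the noise term
  occurs once, outside the sum over the users.  With the receive distortion and noise terms moved
  inside the sum and under that factor, the vector would not minimize the mean-squared error:
  with one user, one access point, one antenna, g = \<rho> = \<kappa>t = \<xi> = 1 and \<kappa>r = Rt = 0, the
  minimizer is 1/3 and that vector is 1/4.
\<close>

definition ha_combiner ::
  "('m::finite \<Rightarrow> 'k set) \<Rightarrow> ('k \<Rightarrow> real) \<Rightarrow> real \<Rightarrow> ('m \<Rightarrow> real) \<Rightarrow> real \<Rightarrow>
   ('k \<Rightarrow> complex ^ ('m \<times> 'l::finite) ^ ('m \<times> 'l)) \<Rightarrow> ('k \<Rightarrow> complex ^ ('m \<times> 'l)) \<Rightarrow>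
   'k set \<Rightarrow> 'k \<Rightarrow> complex ^ ('m \<times> 'l)" where
  "ha_combiner serv \<rho> \<kappa>t \<kappa>r \<xi> Rt g S k =
     \<rho> k *\<^sub>R (pseudo_inverse
        (D_mat serv k **
           ((\<Sum>i\<in>S. (\<rho> i * (1 + \<kappa>t\<^sup>2)) *\<^sub>R outer (g i) (g i)
                   + kr2_mat \<kappa>r ** (\<rho> i *\<^sub>R F_vec (g i)))
            + \<xi> *\<^sub>R mat 1)
         ** D_mat serv k
         + (\<Sum>i\<in>S. D_mat serv k ** Delta \<rho> \<kappa>t \<kappa>r Rt i ** D_mat serv k))
       *v (D_mat serv k *v g k))"

definition ha_pmmse ::
  "('m::finite \<Rightarrow> 'k set) \<Rightarrow> ('k \<Rightarrow> real) \<Rightarrow> real \<Rightarrow> ('m \<Rightarrow> real) \<Rightarrow> real \<Rightarrow>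
   ('k \<Rightarrow> complex ^ ('m \<times> 'l::finite) ^ ('m \<times> 'l)) \<Rightarrow> ('k \<Rightarrow> complex ^ ('m \<times> 'l)) \<Rightarrow>
   'k \<Rightarrow> complex ^ ('m \<times> 'l)" where
  "ha_pmmse serv \<rho> \<kappa>t \<kappa>r \<xi> Rt g k =
     ha_combiner serv \<rho> \<kappa>t \<kappa>r \<xi> Rt g (partners TYPE('l) serv k) k"

section \<open>The mean-squared error is real\<close>

lemma hprod_cnj: "cnj (hprod v w) = hprod w v"
  by (simp add: hprod_def mult.commute)

lemma hprod_ctranspose: "hprod v (A *v w) = hprod (ctranspose A *v v) w"
proof -
  have "hprod v (A *v w) = (\<Sum>p\<in>UNIV. \<Sum>q\<in>UNIV. cnj (v $ p) * (A $ p $ q * w $ q))"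
    by (simp add: hprod_def matrix_vector_mult_def sum_distrib_left)
  also have "\<dots> = (\<Sum>q\<in>UNIV. \<Sum>p\<in>UNIV. cnj (v $ p) * (A $ p $ q * w $ q))"
    by (rule sum.swap)
  also have "\<dots> = hprod (ctranspose A *v v) w"
    by (simp add: hprod_def matrix_vector_mult_def ctranspose_def sum_distrib_right
        sum_distrib_left mult_ac)
  finally show ?thesis .
qed

lemma hermitianI: "(\<And>p q. cnj (A $ q $ p) = A $ p $ q) \<Longrightarrow> hermitian A"
  by (simp add: hermitian_def ctranspose_def vec_eq_iff)

lemma hermitian_entry: "hermitian A \<Longrightarrow> cnj (A $ q $ p) = A $ p $ q"
  unfolding hermitian_def ctranspose_def vec_eq_iff by simp

lemma ctranspose_mult: "ctranspose (A ** B) = ctranspose B ** ctranspose A"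
  by (simp add: ctranspose_def matrix_matrix_mult_def vec_eq_iff mult.commute)

lemma hermitian_D_mat: "hermitian (D_mat serv i)"
  by (rule hermitianI) (auto simp: D_mat_def block_diag_def mat_def)

lemma kr2_mat_mult: "(kr2_mat \<kappa>r ** A) $ p $ q = (\<kappa>r (fst p))\<^sup>2 *\<^sub>R A $ p $ q"
proof -
  have "(kr2_mat \<kappa>r ** A) $ p $ q
      = (\<Sum>r\<in>UNIV. if r = p then (\<kappa>r (fst p))\<^sup>2 *\<^sub>R A $ p $ q else 0)"
    unfolding matrix_matrix_mult_def
    by (auto simp: kr2_mat_def block_diag_def mat_def prod_eq_iff intro!: sum.cong)
  then show ?thesis by simp
qed

lemma hermitian_mse_mat:
  assumes "\<And>i. hermitian (Rt i)"
  shows "hermitian (mse_mat \<rho> \<kappa>t \<kappa>r \<xi> Rt g S)"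
proof (rule hermitianI)
  fix p q
  have 1: "cnj (Rt i $ q $ p) = Rt i $ p $ q" for i p q
    using assms by (rule hermitian_entry)
  have "cnj ((F_vec (g i) + F_mat (Rt i)) $ q $ p) = (F_vec (g i) + F_mat (Rt i)) $ p $ q"
    for i by (auto simp: F_vec_def F_mat_def diag_mat_def 1)
  moreover have "p \<noteq> q \<Longrightarrow> (F_vec (g i) + F_mat (Rt i)) $ p $ q = 0" for i
    by (auto simp: F_vec_def F_mat_def diag_mat_def)
  ultimately have 2: "cnj ((kr2_mat \<kappa>r ** (\<Sum>i\<in>S. \<rho> i *\<^sub>R (F_vec (g i) + F_mat (Rt i)))) $ q $ p)
      = (kr2_mat \<kappa>r ** (\<Sum>i\<in>S. \<rho> i *\<^sub>R (F_vec (g i) + F_mat (Rt i)))) $ p $ q"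
    by (cases "p = q")
      (simp_all add: kr2_mat_mult del: vector_add_component)
  have 3: "cnj ((\<Sum>i\<in>S. (\<rho> i * (1 + \<kappa>t\<^sup>2)) *\<^sub>R (outer (g i) (g i) + Rt i)) $ q $ p)
      = (\<Sum>i\<in>S. (\<rho> i * (1 + \<kappa>t\<^sup>2)) *\<^sub>R (outer (g i) (g i) + Rt i)) $ p $ q"
    by (simp add: outer_def 1 mult.commute)
  show "cnj (mse_mat \<rho> \<kappa>t \<kappa>r \<xi> Rt g S $ q $ p) = mse_mat \<rho> \<kappa>t \<kappa>r \<xi> Rt g S $ p $ q"
    unfolding mse_mat_def vector_add_component complex_cnj_add 2 3
    by (auto simp: mat_def)
qed

lemma mse_complex_real:
  assumes "\<And>i. hermitian (Rt i)"
  shows "mse_complex serv \<rho> \<kappa>t \<kappa>r \<xi> Rt g S k v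
    = complex_of_real (mse serv \<rho> \<kappa>t \<kappa>r \<xi> Rt g S k v)"
proof -
  let ?D = "D_mat serv k" and ?A = "D_mat serv k ** mse_mat \<rho> \<kappa>t \<kappa>r \<xi> Rt g S ** D_mat serv k"
  have D: "ctranspose ?D = ?D"
    using hermitian_D_mat by (simp only: hermitian_def)
  have Q: "ctranspose (mse_mat \<rho> \<kappa>t \<kappa>r \<xi> Rt g S) = mse_mat \<rho> \<kappa>t \<kappa>r \<xi> Rt g S"
    using hermitian_mse_mat[OF assms] by (simp only: hermitian_def)
  have A: "ctranspose ?A = ?A"
    by (simp only: ctranspose_mult D Q matrix_mul_assoc)
  have "cnj (hprod v (?A *v v)) = hprod v (?A *v v)"
    unfolding hprod_cnj by (subst hprod_ctranspose) (simp only: A)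
  moreover have "cnj (hprod v (?D *v g k)) = hprod (g k) (?D *v v)"
    unfolding hprod_cnj by (subst hprod_ctranspose) (simp only: D)
  moreover have "cnj (hprod (g k) (?D *v v)) = hprod v (?D *v g k)"
    unfolding hprod_cnj by (subst hprod_ctranspose) (simp only: D)
  ultimately have "cnj (mse_complex serv \<rho> \<kappa>t \<kappa>r \<xi> Rt g S k v)
      = mse_complex serv \<rho> \<kappa>t \<kappa>r \<xi> Rt g S k v"
    by (simp add: mse_complex_def)
  then have "mse_complex serv \<rho> \<kappa>t \<kappa>r \<xi> Rt g S k v \<in> \<real>"
    by (simp only: Reals_cnj_iff)
  then show ?thesis
    unfolding mse_def by (rule of_real_Re[symmetric])
qed

end

theory Submission
  imports Defs
begin

text \<open>
  With A = D Q D, where Q is the matrix mse_mat, and b = \<rho> k D (g k), the mean-squared error is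
  the quadratic function v^H A v - 2 Re (v^H b) + \<rho> k with A positive semidefinite.  The
  matrix A dominates a positive multiple of the rank-one matrix b b^H, so b is orthogonal to the
  kernel of A and therefore lies in its range.  The minimizers are then the solutions of A v = b,
  and among these the pseudo-inverse of A picks the one orthogonal to the kernel, which is the one
  of least norm.  User k is its own partner unless D = 0, in which case b = 0.
\<close>

section \<open>Hermitian matrices and the real inner product\<close>

text \<open>Complex vectors are treated from here on as a real Euclidean space, so that orthogonal
  decomposition and Pythagoras are available.\<close>

lemma Re_hprod: "Re (hprod v w) = v \<bullet> w"
  by (simp add: hprod_def inner_vec_def inner_complex_def)

lemma inner_ctranspose: "v \<bullet> (A *v w) = (ctranspose A *v v) \<bullet> w"
  by (simp add: hprod_ctranspose flip: Re_hprod)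

lemma inner_hermitian: "hermitian A \<Longrightarrow> v \<bullet> (A *v w) = (A *v v) \<bullet> w"
  by (simp add: inner_ctranspose hermitian_def)

lemma linear_matrix_vector_mult: "linear ((*v) (A :: complex ^ 'n ^ 'm))"
  by (rule linearI)
    (simp_all add: matrix_vector_right_distrib,
      simp add: matrix_vector_mult_def vec_eq_iff scaleR_right.sum)

lemma matrix_vector_mult_axis: "(A :: complex ^ 'n ^ 'm) *v axis j 1 = column j A"
  by (simp add: matrix_vector_mult_def column_def axis_def vec_eq_iff if_distrib[of "\<lambda>x. _ * x"]
      cong: if_cong)

text \<open>For a Hermitian matrix the orthogonal complement of the range is contained in the
  kernel, so the component \<open>z\<close> of \<open>b\<close> orthogonal to the range is killed by
  \<open>A\<close>. Then \<open>z\<close> is orthogonal to \<open>b\<close> and to \<open>u\<close>,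
  hence to itself.\<close>

lemma hermitian_range:
  assumes A: "hermitian A" and ker: "\<And>z. A *v z = 0 \<Longrightarrow> z \<bullet> b = 0"
  shows "b \<in> range ((*v) A)"
proof -
  have "subspace (range ((*v) A))"
    using linear_matrix_vector_mult by (rule linear_subspace_image) (rule subspace_UNIV)
  then obtain u z where u: "u \<in> range ((*v) A)" and z: "\<And>w. w \<in> range ((*v) A) \<Longrightarrow> orthogonal z w"
    and b: "b = u + z"
    using orthogonal_subspace_decomp_exists[of "range ((*v) A)" b]
    by (metis span_eq_iff)
  \<comment> \<open>Moving one factor \<open>A\<close> across gives the product of \<open>z\<close>
    with \<open>A *v (A *v z)\<close>, a vector of the range.\<close>
  have "(A *v z) \<bullet> (A *v z) = 0"
    using z[of "A *v (A *v z)"] by (simp add: orthogonal_def inner_hermitian[OF A])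
  then have "z \<bullet> b = 0"
    by (simp add: ker)
  moreover have "z \<bullet> u = 0"
    using z[OF u] by (simp add: orthogonal_def)
  ultimately have "z = 0"
    by (simp add: b inner_add_right)
  then show ?thesis
    using u b by simp
qed

section \<open>The pseudo-inverse of a Hermitian matrix\<close>

text \<open>\<open>A ** X\<close> and \<open>A ** Y\<close> are Hermitian, and each absorbs the
  other by multiplication, so taking conjugate transposes identifies them; the same holds for
  \<open>X ** A\<close> and \<open>Y ** A\<close>. Then X = X A X = Y A X = Y A Y = Y.\<close>

lemma is_pseudo_inverse_unique:
  assumes X: "is_pseudo_inverse A X" and Y: "is_pseudo_inverse A Y"
  shows "X = Y"
proof -
  have AX: "ctranspose (A ** X) = A ** X" "ctranspose (X ** A) = X ** A"
    and AY: "ctranspose (A ** Y) = A ** Y" "ctranspose (Y ** A) = Y ** A"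
    using X Y by (simp_all add: is_pseudo_inverse_def hermitian_def)
  have "A ** X = (A ** Y) ** (A ** X)"
    using Y by (simp add: is_pseudo_inverse_def matrix_mul_assoc)
  also have "\<dots> = ctranspose ((A ** X) ** (A ** Y))"
    by (subst ctranspose_mult) (simp only: AX AY)
  also have "(A ** X) ** (A ** Y) = A ** Y"
    using X by (simp add: is_pseudo_inverse_def matrix_mul_assoc)
  finally have 1: "A ** X = A ** Y"
    by (simp only: AY)
  have "X ** A = (X ** A) ** (Y ** A)"
    using Y by (simp add: is_pseudo_inverse_def flip: matrix_mul_assoc)
  also have "\<dots> = ctranspose ((Y ** A) ** (X ** A))"
    by (subst ctranspose_mult) (simp only: AX AY)
  also have "(Y ** A) ** (X ** A) = Y ** A"
    using X by (simp add: is_pseudo_inverse_def flip: matrix_mul_assoc)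
  finally have 2: "X ** A = Y ** A"
    by (simp only: AY)
  have "X = X ** A ** X"
    using X by (simp add: is_pseudo_inverse_def)
  also have "\<dots> = Y ** (A ** X)"
    by (simp add: 2 matrix_mul_assoc)
  also have "\<dots> = Y"
    using Y by (simp add: 1 is_pseudo_inverse_def matrix_mul_assoc)
  finally show ?thesis .
qed

text \<open>
  A Hermitian matrix A has the same kernel, hence the same range, as its square, so A = A^2 C for
  some C.  Then C^H A = A C is the orthogonal projection onto the range, and C^H A C is the
  pseudo-inverse.
\<close>

lemma hermitian_pseudo_inverse_exists:
  assumes A: "hermitian A"
  obtains X where "is_pseudo_inverse A X"
proof -
  have cA: "ctranspose A = A"
    using A by (simp add: hermitian_def)
  have hAA: "hermitian (A ** A)"
    by (simp add: hermitian_def ctranspose_mult cA)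
  have "column j A \<in> range ((*v) (A ** A))" for j
  proof (rule hermitian_range[OF hAA])
    fix z assume "(A ** A) *v z = 0"
    \<comment> \<open>This is the squared norm of \<open>A *v z\<close>, since \<open>A\<close> is
      Hermitian.\<close>
    then have "z \<bullet> (A *v (A *v z)) = 0"
      by (simp add: matrix_vector_mul_assoc)
    then have "A *v z = 0"
      using inner_hermitian[OF A, of z "A *v z"] by simp
    then show "z \<bullet> column j A = 0"
      using inner_hermitian[OF A, of z "axis j 1"] by (simp add: matrix_vector_mult_axis)
  qed
  then obtain c where c: "\<And>j. (A ** A) *v c j = column j A"
    unfolding image_iff by metis
  define C where "C = (\<chi> i j. c j $ i)"
  have "column j ((A ** A) ** C) = column j A" for j
    unfolding c[symmetric]
    by (simp add: C_def column_def matrix_matrix_mult_def matrix_vector_mult_def vec_eq_iff)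
  then have AAC: "A ** A ** C = A"
    by (simp add: column_def vec_eq_iff)
  define Y where "Y = ctranspose C"
  have cC: "ctranspose C = Y"
    by (simp add: Y_def)
  have YAA: "Y ** A ** A = A"
    using arg_cong[OF AAC, of ctranspose]
    by (simp add: ctranspose_mult cA cC matrix_mul_assoc)
  \<comment> \<open>Both sides equal Y A A C: contract \<open>A ** A ** C\<close> to
    \<open>A\<close> for the left one, \<open>Y ** A ** A\<close> to \<open>A\<close> for the right
    one.\<close>
  have YA: "Y ** A = A ** C"
    using arg_cong[OF AAC, of "(**) Y"] by (simp only: matrix_mul_assoc YAA)
  have "A ** (Y ** A ** C) = (A ** (A ** C)) ** C"
    by (simp only: matrix_mul_assoc flip: YA)
  then have AX: "A ** (Y ** A ** C) = A ** C"
    by (simp only: matrix_mul_assoc AAC)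
  have "(Y ** A ** C) ** A = Y ** ((A ** C) ** A)"
    by (simp only: matrix_mul_assoc)
  then have XA: "(Y ** A ** C) ** A = A ** C"
    by (simp only: YAA flip: YA)
  have "A ** C ** A = A"
    using YAA by (simp add: YA)
  moreover have "A ** C ** (Y ** A ** C) = Y ** A ** C"
    using arg_cong[OF AX, of "(**) Y"] by (simp only: matrix_mul_assoc YA)
  moreover have "hermitian (A ** C)"
    by (simp add: hermitian_def ctranspose_mult cA cC YA)
  ultimately have "is_pseudo_inverse A (Y ** A ** C)"
    by (simp only: is_pseudo_inverse_def AX XA simp_thms)
  then show thesis ..
qed

lemma is_pseudo_inverse_pseudo_inverse:
  assumes "hermitian A"
  shows "is_pseudo_inverse A (pseudo_inverse A)"
  unfolding pseudo_inverse_def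
  by (rule hermitian_pseudo_inverse_exists[OF assms], rule theI)
    (auto intro: is_pseudo_inverse_unique)

section \<open>Positive semidefinite matrices\<close>

lemma psd_iff_inner: "psd A \<longleftrightarrow> hermitian A \<and> (\<forall>v. 0 \<le> v \<bullet> (A *v v))"
  by (simp add: psd_def Re_hprod)

lemma scaleR_matrix_vector: "(c *\<^sub>R A) *v v = c *\<^sub>R (A *v (v :: complex ^ 'n))"
  by (simp add: matrix_vector_mult_def vec_eq_iff scaleR_right.sum)

lemma psd_0: "psd 0"
  by (simp add: psd_iff_inner hermitian_def ctranspose_def vec_eq_iff)

lemma psd_add: "psd A \<Longrightarrow> psd B \<Longrightarrow> psd (A + B)"
  by (simp add: psd_iff_inner hermitian_def ctranspose_def vec_eq_iff
      matrix_vector_mult_add_rdistrib inner_add_right)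

lemma psd_scaleR: "0 \<le> c \<Longrightarrow> psd A \<Longrightarrow> psd (c *\<^sub>R A)"
  by (simp add: psd_iff_inner hermitian_def ctranspose_def vec_eq_iff scaleR_matrix_vector)

text \<open>Over an infinite \<open>S\<close> the sum is 0 by convention, and \<open>psd_0\<close>
  applies.\<close>

lemma psd_sum: "(\<And>i. i \<in> S \<Longrightarrow> psd (A i)) \<Longrightarrow> psd (\<Sum>i\<in>S. A i)"
  by (induction S rule: infinite_finite_induct) (simp_all add: psd_0 psd_add)

lemma psd_congruence:
  assumes "psd A"
  shows "psd (ctranspose B ** A ** B)"
proof -
  have "ctranspose (ctranspose B) = B"
    by (simp add: ctranspose_def vec_eq_iff)
  moreover have "v \<bullet> ((ctranspose B ** A ** B) *v v) = (B *v v) \<bullet> (A *v (B *v v))" for v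
    by (simp add: inner_ctranspose[of _ "ctranspose B"] calculation
        flip: matrix_vector_mul_assoc)
  ultimately show ?thesis
    using assms by (simp add: psd_iff_inner hermitian_def ctranspose_mult matrix_mul_assoc)
qed

lemma inner_outer: "v \<bullet> (outer g g *v v) = (cmod (hprod g v))\<^sup>2"
proof -
  have "outer g g *v v = (\<chi> p. g $ p * hprod g v)"
    by (simp add: outer_def hprod_def matrix_vector_mult_def vec_eq_iff sum_distrib_left mult_ac)
  then have "hprod v (outer g g *v v) = hprod v g * hprod g v"
    by (simp add: hprod_def[of v] sum_distrib_left mult_ac)
  also have "\<dots> = complex_of_real ((cmod (hprod g v))\<^sup>2)"
    by (metis complex_norm_square hprod_cnj mult.commute)
  finally show ?thesis
    by (simp flip: Re_hprod)
qed

lemma psd_outer: "psd (outer g g)"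
  unfolding psd_iff_inner inner_outer
  by (auto intro!: hermitianI simp: outer_def mult.commute)

lemma psd_diag_mat:
  assumes "\<And>p. 0 \<le> d p"
  shows "psd (diag_mat (\<lambda>p. complex_of_real (d p)))"
proof -
  have "diag_mat (\<lambda>p. complex_of_real (d p)) *v v = (\<chi> p. d p *\<^sub>R v $ p)" for v
    by (simp add: diag_mat_def matrix_vector_mult_def vec_eq_iff if_distrib[of "\<lambda>x. x * _"]
        scaleR_conv_of_real cong: if_cong)
  then show ?thesis
    using assms
    by (auto simp: psd_iff_inner inner_vec_def hermitian_def ctranspose_def diag_mat_def vec_eq_iff
        intro!: sum_nonneg)
qed

text \<open>Testing the form on a unit vector gives the sign. The diagonal is brought into the real
  form that \<open>psd_diag_mat\<close> expects.\<close>

lemma psd_diag_entry: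
  assumes "psd A"
  shows "A $ p $ p = complex_of_real (Re (A $ p $ p))" and "0 \<le> Re (A $ p $ p)"
proof -
  show "A $ p $ p = complex_of_real (Re (A $ p $ p))"
    using assms hermitian_entry[of A p p] by (simp add: psd_def Reals_cnj_iff)
  have "A $ p $ p = hprod (axis p 1) (A *v axis p 1)"
    unfolding matrix_vector_mult_axis
    by (simp add: hprod_def column_def axis_def if_distrib[of "\<lambda>x. x * _"] if_distrib[of cnj] cong: if_cong)
  then show "0 \<le> Re (A $ p $ p)"
    using assms by (simp add: psd_def)
qed

lemma psd_F_vec: "psd (F_vec h)"
  unfolding F_vec_def by (rule psd_diag_mat) simp

lemma psd_F_mat:
  assumes "psd A"
  shows "psd (F_mat A)"
  unfolding F_mat_def
  by (subst psd_diag_entry(1)[OF assms]) (intro psd_diag_mat psd_diag_entry(2) assms)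

section \<open>Minimizing a positive semidefinite quadratic function\<close>

text \<open>If \<open>A *v w\<close> were nonzero, a small step from \<open>w\<close> against this
  direction would make the form negative: the first-order change is strictly negative, and the form
  starts at 0.\<close>

lemma psd_kernel:
  assumes A: "psd A" and w: "w \<bullet> (A *v w) = 0"
  shows "A *v w = 0"
proof (rule ccontr)
  assume "A *v w \<noteq> 0"
  define z where "z = A *v w"
  define q where "q = z \<bullet> (A *v z)"
  \<comment> \<open>The summand 1 keeps the denominator positive when \<open>q\<close> is 0, and
    \<open>t * q\<close> stays below \<open>z \<bullet> z\<close>.\<close>
  define t where "t = (z \<bullet> z) / (q + 1)"
  have z: "0 < z \<bullet> z"
    using \<open>A *v w \<noteq> 0\<close> by (simp add: z_def)
  have q: "0 \<le> q"
    using A by (simp add: psd_iff_inner q_def)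
  have t: "0 < t" "t * q < 2 * (z \<bullet> z)"
    using z q by (simp_all add: t_def divide_simps algebra_simps add_pos_nonneg add_strict_increasing2)
  have "w \<bullet> (A *v z) = z \<bullet> z"
    using A by (simp add: psd_iff_inner inner_hermitian z_def)
  then have "(w - t *\<^sub>R z) \<bullet> (A *v (w - t *\<^sub>R z)) = t * (t * q - 2 * (z \<bullet> z))"
    using w by (simp add: linear_diff[OF linear_matrix_vector_mult]
        linear_cmul[OF linear_matrix_vector_mult] inner_diff_left inner_diff_right algebra_simps
        flip: z_def q_def)
  also have "\<dots> < 0"
    using t by (simp add: mult_pos_neg)
  finally show False
    using A by (auto simp: psd_iff_inner not_le[symmetric])
qed

text \<open>Expanding around a solution \<open>u\<close> of A u = b, the linear terms cancel and
  only the form at the displacement remains. It is nonnegative and by \<open>psd_kernel\<close>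
  vanishes only on the kernel, so the minimizers are exactly the solutions.\<close>

lemma psd_quadratic_minimizers:
  assumes A: "psd A" and b: "b \<in> range ((*v) A)"
  shows "is_arg_min (\<lambda>v. v \<bullet> (A *v v) - 2 * (v \<bullet> b) + c) (\<lambda>_. True) v \<longleftrightarrow> A *v v = b"
proof -
  let ?f = "\<lambda>v. v \<bullet> (A *v v) - 2 * (v \<bullet> b) + c"
  have herm: "hermitian A" and nn: "\<And>w. 0 \<le> w \<bullet> (A *v w)"
    using A by (simp_all add: psd_iff_inner)
  have shift: "?f (u + w) = ?f u + w \<bullet> (A *v w)" if "A *v u = b" for u w
    using that inner_hermitian[OF herm, of u w]
    by (simp add: matrix_vector_right_distrib inner_add_left inner_add_right inner_commute)
  obtain u where u: "A *v u = b"
    using b by blast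
  show ?thesis
  proof
    assume "is_arg_min ?f (\<lambda>_. True) v"
    then have "?f v \<le> ?f u"
      by (simp add: is_arg_min_linorder)
    then have "(v - u) \<bullet> (A *v (v - u)) \<le> 0"
      using shift[OF u, of "v - u"] by simp
    then have "A *v (v - u) = 0"
      using nn by (intro psd_kernel[OF A]) (simp add: order_antisym)
    then show "A *v v = b"
      by (simp add: u linear_diff[OF linear_matrix_vector_mult])
  next
    assume v: "A *v v = b"
    show "is_arg_min ?f (\<lambda>_. True) v"
      unfolding is_arg_min_linorder using shift[OF v, of "w - v" for w] nn
      by (metis add.commute diff_add_cancel le_add_same_cancel1)
  qed
qed

text \<open>Any solution differs from \<open>X *v b\<close> by a kernel vector \<open>z\<close>.
  Since X b = (X A) (X b) with \<open>X ** A\<close> Hermitian and (X A) z = 0, the two are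
  orthogonal, and Pythagoras gives both minimality and uniqueness.\<close>

lemma psd_quadratic_min_norm_minimizer:
  assumes A: "psd A" and b: "b \<in> range ((*v) A)"
  shows "min_norm_minimizer (\<lambda>v. v \<bullet> (A *v v) - 2 * (v \<bullet> b) + c) v
    \<longleftrightarrow> v = pseudo_inverse A *v b"
proof -
  define X where "X = pseudo_inverse A"
  have "hermitian A"
    using A by (simp add: psd_def)
  then have AXA: "A ** X ** A = A" and XAX: "X ** A ** X = X" and XA: "hermitian (X ** A)"
    using is_pseudo_inverse_pseudo_inverse[of A] by (auto simp: X_def is_pseudo_inverse_def)
  have sol: "A *v (X *v b) = b"
    using b AXA by (auto simp: matrix_vector_mul_assoc)
  have norm: "(norm w)\<^sup>2 = (norm (X *v b))\<^sup>2 + (norm (w - X *v b))\<^sup>2" if "A *v w = b" for w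
  proof -
    define z where "z = w - X *v b"
    have "A *v z = 0"
      by (simp add: z_def linear_diff[OF linear_matrix_vector_mult] that sol)
    then have "(X ** A) *v z = 0"
      by (simp flip: matrix_vector_mul_assoc)
    then have "((X ** A) *v (X *v b)) \<bullet> z = 0"
      by (simp flip: inner_hermitian[OF XA])
    then have "(X *v b) \<bullet> z = 0"
      by (simp add: matrix_vector_mul_assoc XAX)
    then have "orthogonal (X *v b) z"
      by (simp add: orthogonal_def)
    then show ?thesis
      using norm_add_Pythagorean[of "X *v b" z] by (simp add: z_def)
  qed
  have "norm (X *v b) \<le> norm w" if "A *v w = b" for w
    by (rule power2_le_imp_le) (simp_all add: norm[OF that])
  moreover have "w = X *v b" if "A *v w = b" "norm w \<le> norm (X *v b)" for w
    using norm[OF that(1)] power_mono[OF that(2), of 2] by simp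
  ultimately show ?thesis
    unfolding min_norm_minimizer_def psd_quadratic_minimizers[OF assms]
    unfolding is_arg_min_linorder X_def[symmetric] using sol by metis
qed

section \<open>The mean-squared error of the uplink\<close>

lemma kr2_mat_diag_mat:
  "kr2_mat \<kappa>r ** diag_mat d = diag_mat (\<lambda>p. complex_of_real ((\<kappa>r (fst p))\<^sup>2) * d p)"
  by (simp add: vec_eq_iff kr2_mat_mult) (simp add: diag_mat_def scaleR_conv_of_real)

text \<open>A product of positive semidefinite matrices need not be Hermitian; here both factors are
  diagonal, so the nonnegative entries simply multiply.\<close>

lemma psd_kr2_mat_mult:
  assumes "psd (diag_mat d)"
  shows "psd (kr2_mat \<kappa>r ** diag_mat d)"
proof -
  have d: "d p = complex_of_real (Re (d p))" "0 \<le> Re (d p)" for p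
    using psd_diag_entry[OF assms, of p] by (simp_all add: diag_mat_def)
  have "psd (diag_mat (\<lambda>p. complex_of_real ((\<kappa>r (fst p))\<^sup>2 * Re (d p))))"
    by (rule psd_diag_mat) (simp add: d(2))
  then show ?thesis
    unfolding kr2_mat_diag_mat of_real_mult by (simp only: d(1)[symmetric])
qed

text \<open>The contribution of one user to \<open>mse_mat\<close>, bracketed so that the rank-one
  term can be split off from a positive semidefinite remainder.\<close>

definition user_mat ::
  "('k \<Rightarrow> real) \<Rightarrow> real \<Rightarrow> ('m::finite \<Rightarrow> real) \<Rightarrow>
   ('k \<Rightarrow> complex ^ ('m \<times> 'l::finite) ^ ('m \<times> 'l)) \<Rightarrow>
   ('k \<Rightarrow> complex ^ ('m \<times> 'l)) \<Rightarrow> 'k \<Rightarrow> complex ^ ('m \<times> 'l) ^ ('m \<times> 'l)" where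
  "user_mat \<rho> \<kappa>t \<kappa>r Rt g i =
     (\<rho> i * (1 + \<kappa>t\<^sup>2)) *\<^sub>R outer (g i) (g i) + (kr2_mat \<kappa>r ** (\<rho> i *\<^sub>R F_vec (g i))
     + Delta \<rho> \<kappa>t \<kappa>r Rt i)"

lemma matrix_add_rdistrib: "(A + B) ** C = A ** C + B ** (C :: complex ^ 'n ^ 'p)"
  by (simp add: matrix_matrix_mult_def vec_eq_iff distrib_right sum.distrib)

lemma matrix_mult_sum_right: "B ** (\<Sum>i\<in>S. A i) = (\<Sum>i\<in>S. B ** (A i :: complex ^ 'n ^ 'p))"
  by (induction S rule: infinite_finite_induct) (simp_all add: matrix_add_ldistrib)

lemma matrix_mult_sum_left: "(\<Sum>i\<in>S. A i) ** B = (\<Sum>i\<in>S. A i ** (B :: complex ^ 'n ^ 'p))"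
  by (induction S rule: infinite_finite_induct) (simp_all add: matrix_add_rdistrib)

lemma mse_mat_eq_sum: "mse_mat \<rho> \<kappa>t \<kappa>r \<xi> Rt g S = (\<Sum>i\<in>S. user_mat \<rho> \<kappa>t \<kappa>r Rt g i) + \<xi> *\<^sub>R mat 1"
  by (simp add: mse_mat_def user_mat_def Delta_def matrix_mult_sum_right scaleR_add_right
      matrix_add_ldistrib sum.distrib algebra_simps)

text \<open>Distributing \<open>D_mat serv k\<close> over the sums shows that the matrix inverted in
  the combiner is the one of the quadratic form; the factor \<open>\<rho> k\<close> moves onto the
  vector by linearity.\<close>

lemma ha_combiner_eq:
  "ha_combiner serv \<rho> \<kappa>t \<kappa>r \<xi> Rt g S k = pseudo_inverse
     (D_mat serv k ** mse_mat \<rho> \<kappa>t \<kappa>r \<xi> Rt g S ** D_mat serv k) *v (\<rho> k *\<^sub>R (D_mat serv k *v g k))"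
  unfolding ha_combiner_def linear_cmul[OF linear_matrix_vector_mult, symmetric]
  by (rule arg_cong[where f = "\<lambda>A. pseudo_inverse A *v _"])
    (simp add: mse_mat_eq_sum user_mat_def matrix_mult_sum_right matrix_mult_sum_left
      matrix_add_ldistrib matrix_add_rdistrib sum.distrib)

lemma psd_user_rest:
  assumes "0 \<le> \<rho> i" and "psd (Rt i)"
  shows "psd (kr2_mat \<kappa>r ** (\<rho> i *\<^sub>R F_vec (g i)) + Delta \<rho> \<kappa>t \<kappa>r Rt i)"
proof -
  have diag: "\<rho> i *\<^sub>R diag_mat d = diag_mat (\<lambda>p. \<rho> i *\<^sub>R d p)" for d
    by (simp add: diag_mat_def vec_eq_iff)
  have "psd (kr2_mat \<kappa>r ** (\<rho> i *\<^sub>R F_vec (g i)))" "psd (kr2_mat \<kappa>r ** (\<rho> i *\<^sub>R F_mat (Rt i)))"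
    using psd_scaleR[OF assms(1) psd_F_vec[of "g i"]] psd_scaleR[OF assms(1) psd_F_mat[OF assms(2)]]
    unfolding F_vec_def F_mat_def diag by (auto intro: psd_kr2_mat_mult)
  then show ?thesis
    unfolding Delta_def using assms by (intro psd_add psd_scaleR) auto
qed

lemma psd_user_mat:
  assumes "0 \<le> \<rho> i" and "psd (Rt i)"
  shows "psd (user_mat \<rho> \<kappa>t \<kappa>r Rt g i)"
  unfolding user_mat_def using assms by (intro psd_add psd_scaleR psd_outer psd_user_rest) auto

lemma psd_mat_1: "psd (mat 1)"
  by (simp add: psd_iff_inner) (auto intro!: hermitianI simp: mat_def)

text \<open>Not being one's own partner means that the square of this Hermitian matrix is 0, so
  every image vector has norm 0.\<close>

lemma D_mat_0_if_not_partner: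
  assumes "k \<notin> partners TYPE('l::finite) serv k"
  shows "(D_mat serv k :: complex ^ ('m::finite \<times> 'l) ^ ('m \<times> 'l)) = 0"
proof -
  let ?D = "D_mat serv k :: complex ^ ('m::finite \<times> 'l) ^ ('m \<times> 'l)"
  have "ctranspose ?D = ?D"
    unfolding hermitian_def[symmetric] by (rule hermitian_D_mat)
  moreover have "?D ** ?D = 0"
    using assms by (simp add: partners_def)
  ultimately have "(?D *v v) \<bullet> (?D *v v) = 0" for v
    by (simp only: inner_ctranspose[of "?D *v v"] matrix_vector_mul_assoc)
      (simp only: matrix_vector_mult_0 inner_zero_left)
  then show ?thesis
    by (simp add: matrix_eq)
qed

text \<open>Keeping \<open>S\<close> general treats the full and the partial problem at
  once.\<close>

lemma min_norm_minimizer_mse: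
  fixes serv :: "'m::finite \<Rightarrow> 'k set"
    and Rt :: "'k \<Rightarrow> complex ^ ('m \<times> 'l::finite) ^ ('m \<times> 'l)"
  assumes \<rho>: "\<And>i. 0 \<le> \<rho> i" and \<xi>: "0 \<le> \<xi>" and Rt: "\<And>i. psd (Rt i)"
    and S: "finite S" "partners TYPE('l) serv k \<subseteq> S"
  shows "min_norm_minimizer (mse serv \<rho> \<kappa>t \<kappa>r \<xi> Rt g S k) v
    \<longleftrightarrow> v = ha_combiner serv \<rho> \<kappa>t \<kappa>r \<xi> Rt g S k"
proof -
  define D :: "complex ^ ('m \<times> 'l) ^ ('m \<times> 'l)" where "D = D_mat serv k"
  define Q where "Q = mse_mat \<rho> \<kappa>t \<kappa>r \<xi> Rt g S"
  define b where "b = \<rho> k *\<^sub>R (D *v g k)"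
  have D: "hermitian D"
    unfolding D_def by (rule hermitian_D_mat)
  have "psd Q"
    unfolding Q_def mse_mat_eq_sum
    using assms by (intro psd_add psd_sum psd_user_mat psd_scaleR psd_mat_1) auto
  then have A: "psd (D ** Q ** D)"
    using psd_congruence[of Q D] D by (simp add: hermitian_def)
  have "b \<in> range ((*v) (D ** Q ** D))"
  proof (cases "k \<in> S")
    case True
    show ?thesis
    proof (rule hermitian_range)
      show "hermitian (D ** Q ** D)"
        using A by (simp add: psd_def)
      fix z assume z: "(D ** Q ** D) *v z = 0"
      define w where "w = D *v z"
      have "z \<bullet> ((D ** Q ** D) *v z) = w \<bullet> (Q *v w)"
        by (simp add: w_def inner_hermitian[OF D] flip: matrix_vector_mul_assoc)
      then have "w \<bullet> (Q *v w) = 0"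
        by (simp add: z)
      \<comment> \<open>\<open>P\<close> is what remains of \<open>Q\<close> without the rank-one
        term of user \<open>k\<close>. Its positivity bounds that term by the whole form, which is 0
        at \<open>w\<close>.\<close>
      define P where "P = kr2_mat \<kappa>r ** (\<rho> k *\<^sub>R F_vec (g k)) + Delta \<rho> \<kappa>t \<kappa>r Rt k
        + ((\<Sum>i\<in>S - {k}. user_mat \<rho> \<kappa>t \<kappa>r Rt g i) + \<xi> *\<^sub>R mat 1)"
      have "psd P"
        unfolding P_def using assms
        by (intro psd_add[OF psd_user_rest] psd_add psd_sum psd_user_mat psd_scaleR psd_mat_1) auto
      moreover have "Q = (\<rho> k * (1 + \<kappa>t\<^sup>2)) *\<^sub>R outer (g k) (g k) + P"
        unfolding Q_def mse_mat_eq_sum sum.remove[OF S(1) True] P_def user_mat_def[of _ _ _ _ _ k]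
        by (simp add: add_ac)
      ultimately have "\<rho> k * (1 + \<kappa>t\<^sup>2) * (cmod (hprod (g k) w))\<^sup>2 \<le> w \<bullet> (Q *v w)"
        by (simp add: psd_iff_inner matrix_vector_mult_add_rdistrib inner_add_right
            scaleR_matrix_vector inner_outer)
      then have "\<rho> k * (1 + \<kappa>t\<^sup>2) * (cmod (hprod (g k) w))\<^sup>2 = 0"
        using \<rho>[of k] \<open>w \<bullet> (Q *v w) = 0\<close> by (intro order_antisym) auto
      moreover have "1 + \<kappa>t\<^sup>2 \<noteq> 0"
        by (metis add_pos_nonneg less_irrefl zero_le_power2 zero_less_one)
      \<comment> \<open>Either case suffices, because \<open>b\<close> carries the factor
        \<open>\<rho> k\<close>.\<close>
      ultimately have "\<rho> k = 0 \<or> hprod (g k) w = 0"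
        by simp
      then have "\<rho> k * (w \<bullet> g k) = 0"
        using Re_hprod[of "g k" w] by (auto simp: inner_commute[of w])
      then show "z \<bullet> b = 0"
        by (simp add: b_def w_def inner_hermitian[OF D])
    qed
  next
    case False
    then have "D = 0"
      using S D_mat_0_if_not_partner[of k serv] by (auto simp: D_def)
    then have "b = 0"
      by (simp add: b_def)
    then show ?thesis
      by (auto simp: image_iff intro!: exI[of _ 0])
  qed
  note * = psd_quadratic_min_norm_minimizer[OF A this, of "\<rho> k"]
  \<comment> \<open>The two linear terms of the mean-squared error have the same real part, whence
    the factor 2 of the quadratic function.\<close>
  have "g k \<bullet> (D *v v) = v \<bullet> (D *v g k)" for v
    using inner_hermitian[OF D, of "g k" v] inner_commute by metis
  then have "mse serv \<rho> \<kappa>t \<kappa>r \<xi> Rt g S k = (\<lambda>v. v \<bullet> ((D ** Q ** D) *v v) - 2 * (v \<bullet> b) + \<rho> k)"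
    by (intro ext) (simp add: mse_def mse_complex_def Re_hprod b_def flip: D_def Q_def)
  then show ?thesis
    using * by (simp add: ha_combiner_eq b_def D_def Q_def)
qed

theorem proposition3:
  fixes serv :: "'m::finite \<Rightarrow> 'k::finite set"
    and \<rho> :: "'k \<Rightarrow> real" and \<kappa>t :: real and \<kappa>r :: "'m \<Rightarrow> real" and \<xi> :: real
    and R \<Phi> Rt :: "'k \<Rightarrow> complex ^ ('m \<times> 'l::finite) ^ ('m \<times> 'l)"
    and hhat :: "nat \<Rightarrow> 'k \<Rightarrow> complex ^ ('m \<times> 'l)"
    and n :: nat and k :: 'k
  assumes "\<And>i. 0 \<le> \<rho> i" and "0 \<le> \<xi>"
    and "\<And>i. psd (R i)" and "\<And>i. R i \<in> range block_diag"
    and "\<And>i. psd (\<Phi> i)" and "\<And>i. \<Phi> i \<in> range block_diag"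
    and "\<And>i. Rt i = R i - \<Phi> i" and "\<And>i. psd (Rt i)"
  shows "(\<forall>v. min_norm_minimizer (mse serv \<rho> \<kappa>t \<kappa>r \<xi> Rt (hhat n) UNIV k) v
            \<longleftrightarrow> v = ha_combiner serv \<rho> \<kappa>t \<kappa>r \<xi> Rt (hhat n) UNIV k)
       \<and> (\<forall>v. min_norm_minimizer
                (mse serv \<rho> \<kappa>t \<kappa>r \<xi> Rt (hhat n) (partners TYPE('l) serv k) k) v
            \<longleftrightarrow> v = ha_pmmse serv \<rho> \<kappa>t \<kappa>r \<xi> Rt (hhat n) k)"
  \<comment> \<open>Both conjuncts are instances of one lemma, with \<open>S\<close> the set of all
    users and then the set of partners; each contains the partners.\<close>
  unfolding ha_pmmse_def using assms by (intro conjI allI min_norm_minimizer_mse) auto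

end
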